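(* Let $I\subset\mathbb{R}$ be an open interval, let $a,b\in I$ with $a<b$, and let $f:I\to\mathbb{R}$ be a twice differentiable function. Let $\gamma,\Gamma$ be real numbers such that $\gamma\le f''(t)\le\Gamma$ for all $t\in[a,b]$. Then $$\left|\frac{b-a}{90}\left[7f(a)+32f\left(\frac{3a+b}{4}\right)+12f\left(\frac{a+b}{2}\right)+32f\left(\frac{a+3b}{4}\right)+7f(b)\right]-\int_a^b f(t)\,dt\right|\le\frac{509}{273375}(\Gamma-\gamma)(b-a)^3.$$
   Context: No continuity of $f''$ is assumed. *)

theory Defs
  imports "HOL-Analysis.Analysis"
begin

end

theory Submission
  imports Defs
begin

text \<open>
  Rescale \<open>[a, b]\<close> to \<open>[0, 1]\<close> and split it at the midpoint; the right half is treated as the left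
  half of the reflected function. Integrating by parts twice on \<open>[0, 1/2]\<close> turns the error of each
  half into the integral of \<open>g''\<close> against the Peano kernel, which is \<open>t (7/45 - t) / 2\<close> on \<open>[0, 1/4]\<close>
  and \<open>(t - 1/3) (8/15 - t) / 2\<close> on \<open>[1/4, 1/2]\<close>, plus a term in \<open>g' (1/2)\<close> that cancels
  between the halves. This kernel has mean zero on \<open>[0, 1/2]\<close>, it changes sign at \<open>7/45\<close> and \<open>1/3\<close>,
  and its positive part has integral \<open>509/546750\<close>. Integrals are of
  Henstock-Kurzweil type, so \<open>g''\<close> need not be continuous.
\<close>

text \<open>The function \<open>k t * g' t - k' t * g t\<close> is an antiderivative of
  \<open>k t * g'' t - c * g t\<close>: the terms \<open>k' t * g' t\<close> cancel and
  \<open>k'' = c\<close> is constant. The fundamental theorem for the Henstock-Kurzweil integral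
  then yields integrability of \<open>k t * g'' t\<close> along with its value.\<close>

lemma has_integral_by_parts_twice_quadratic:
  fixes g g' g'' k k' :: "real \<Rightarrow> real"
  assumes "p \<le> q"
    and g: "\<And>t. t \<in> {p..q} \<Longrightarrow> (g has_real_derivative g' t) (at t within {p..q})"
    and g': "\<And>t. t \<in> {p..q} \<Longrightarrow> (g' has_real_derivative g'' t) (at t within {p..q})"
    and k: "\<And>t. (k has_real_derivative k' t) (at t)"
    and k': "\<And>t. (k' has_real_derivative c) (at t)"
  shows "((\<lambda>t. k t * g'' t) has_integral
           (k q * g' q - k' q * g q) - (k p * g' p - k' p * g p) + c * integral {p..q} g) {p..q}"
proof -
  have "continuous_on {p..q} g"
    using g by (meson DERIV_continuous continuous_on_eq_continuous_within)
  then have "(g has_integral integral {p..q} g) {p..q}"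
    by (simp add: integrable_continuous_interval integrable_integral)
  then have "((\<lambda>t. c * g t) has_integral c * integral {p..q} g) {p..q}"
    by (rule has_integral_mult_right)
  moreover have "((\<lambda>t. k t * g'' t - c * g t) has_integral
           (k q * g' q - k' q * g q) - (k p * g' p - k' p * g p)) {p..q}"
  proof (rule fundamental_theorem_of_calculus[OF \<open>p \<le> q\<close>])
    fix t assume t: "t \<in> {p..q}"
    have "((\<lambda>t. k t * g' t - k' t * g t) has_real_derivative k t * g'' t - c * g t)
            (at t within {p..q})"
      by (rule derivative_eq_intros g[OF t] g'[OF t] k[THEN has_field_derivative_at_within]
          k'[THEN has_field_derivative_at_within] refl)+ (simp add: algebra_simps)
    then show "((\<lambda>t. k t * g' t - k' t * g t) has_vector_derivative k t * g'' t - c * g t)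
            (at t within {p..q})"
      by (simp add: has_real_derivative_iff_has_vector_derivative)
  qed
  ultimately have "((\<lambda>t. (k t * g'' t - c * g t) + c * g t) has_integral
           (k q * g' q - k' q * g q) - (k p * g' p - k' p * g p) + c * integral {p..q} g) {p..q}"
    by (rule has_integral_add[rotated])
  then show ?thesis
    by simp
qed

lemma has_integral_weighted_bounds:
  fixes k u :: "real \<Rightarrow> real"
  assumes ku: "((\<lambda>t. k t * u t) has_integral X) S" and k: "(k has_integral Y) S"
    and nonneg: "\<And>t. t \<in> S \<Longrightarrow> 0 \<le> k t"
    and u: "\<And>t. t \<in> S \<Longrightarrow> \<gamma> \<le> u t \<and> u t \<le> \<Gamma>"
  shows "\<gamma> * Y \<le> X" "X \<le> \<Gamma> * Y"
proof -
  show "\<gamma> * Y \<le> X"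
    by (rule has_integral_le[OF has_integral_mult_right[OF k] ku])
      (metis mult.commute mult_left_mono nonneg u)
  show "X \<le> \<Gamma> * Y"
    by (rule has_integral_le[OF ku has_integral_mult_right[OF k]])
      (metis mult.commute mult_left_mono nonneg u)
qed

text \<open>Writing \<open>k\<close> through its roots \<open>r\<close>, \<open>s\<close> makes its
  sign on a piece easy to read off, and \<open>c\<close> is both \<open>k''\<close> and the
  coefficient of the integral of \<open>g\<close>. Since \<open>k\<close> is nonnegative, the bounds
  on \<open>g''\<close> carry over to the weighted integral; \<open>F\<close> is an antiderivative
  of \<open>k\<close>.\<close>

lemma quadratic_kernel_bounds:
  fixes g g' g'' :: "real \<Rightarrow> real" and c r s p q :: real
  defines "k \<equiv> \<lambda>t. c * ((t - r) * (t - s)) / 2"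
    and "k' \<equiv> \<lambda>t. c * (t - (r + s) / 2)"
    and "F \<equiv> \<lambda>t. c * (t ^ 3 / 3 - (r + s) * t ^ 2 / 2 + r * s * t) / 2"
  assumes "p \<le> q"
    and g: "\<And>t. t \<in> {p..q} \<Longrightarrow> (g has_real_derivative g' t) (at t within {p..q})"
    and g': "\<And>t. t \<in> {p..q} \<Longrightarrow> (g' has_real_derivative g'' t) (at t within {p..q})"
    and nonneg: "\<And>t. t \<in> {p..q} \<Longrightarrow> 0 \<le> k t"
    and g'': "\<And>t. t \<in> {p..q} \<Longrightarrow> \<gamma> \<le> g'' t \<and> g'' t \<le> \<Gamma>"
  shows "\<gamma> * (F q - F p)
          \<le> (k q * g' q - k' q * g q) - (k p * g' p - k' p * g p) + c * integral {p..q} g"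
    and "(k q * g' q - k' q * g q) - (k p * g' p - k' p * g p) + c * integral {p..q} g
          \<le> \<Gamma> * (F q - F p)"
proof -
  have "(k has_real_derivative k' t) (at t)" for t
    unfolding k_def k'_def
    by (rule derivative_eq_intros refl | simp)+ (simp add: algebra_simps)
  moreover have "(k' has_real_derivative c) (at t)" for t
    unfolding k'_def by (rule derivative_eq_intros refl | simp)+
  ultimately have kg: "((\<lambda>t. k t * g'' t) has_integral
      (k q * g' q - k' q * g q) - (k p * g' p - k' p * g p) + c * integral {p..q} g) {p..q}"
    using has_integral_by_parts_twice_quadratic[OF \<open>p \<le> q\<close> g g'] by blast
  have "(k has_integral F q - F p) {p..q}"
  proof (rule fundamental_theorem_of_calculus[OF \<open>p \<le> q\<close>])
    fix t
    have "(F has_real_derivative k t) (at t within {p..q})"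
      unfolding k_def F_def
      by (rule derivative_eq_intros refl | simp)+ (simp add: algebra_simps power2_eq_square)
    then show "(F has_vector_derivative k t) (at t within {p..q})"
      by (simp add: has_real_derivative_iff_has_vector_derivative)
  qed
  note bounds = has_integral_weighted_bounds[OF kg this nonneg g'']
  show "\<gamma> * (F q - F p)
          \<le> (k q * g' q - k' q * g q) - (k p * g' p - k' p * g p) + c * integral {p..q} g"
    by (rule bounds)
  show "(k q * g' q - k' q * g q) - (k p * g' p - k' p * g p) + c * integral {p..q} g
          \<le> \<Gamma> * (F q - F p)"
    by (rule bounds)
qed

text \<open>Let K be the Peano kernel on [0, 1/2]. The weights come from its slope: 7/90 at 0, a
  jump of 32/90 at 1/4, and -6/90 at 1/2, half of Boole's midpoint weight. As K vanishes at 0 and is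
  continuous at 1/4, the only value of \<open>g'\<close> left is at 1/2, with factor K(1/2) =
  1/360.\<close>

lemma boole_half_interval_bound:
  fixes g g' g'' :: "real \<Rightarrow> real"
  assumes g: "\<And>t. t \<in> {0..1/2} \<Longrightarrow> (g has_real_derivative g' t) (at t within {0..1/2})"
    and g': "\<And>t. t \<in> {0..1/2} \<Longrightarrow> (g' has_real_derivative g'' t) (at t within {0..1/2})"
    and g'': "\<And>t. t \<in> {0..1/2} \<Longrightarrow> \<gamma> \<le> g'' t \<and> g'' t \<le> \<Gamma>"
  shows "\<bar>7/90 * g 0 + 32/90 * g (1/4) + 6/90 * g (1/2) + g' (1/2) / 360 - integral {0..1/2} g\<bar>
          \<le> 509/546750 * (\<Gamma> - \<gamma>)"
proof -
  have bounds:
    "\<gamma> * (c * (q ^ 3 / 3 - (r + s) * q ^ 2 / 2 + r * s * q) / 2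
        - c * (p ^ 3 / 3 - (r + s) * p ^ 2 / 2 + r * s * p) / 2)
      \<le> (c * ((q - r) * (q - s)) / 2 * g' q - c * (q - (r + s) / 2) * g q)
        - (c * ((p - r) * (p - s)) / 2 * g' p - c * (p - (r + s) / 2) * g p)
        + c * integral {p..q} g
    \<and> (c * ((q - r) * (q - s)) / 2 * g' q - c * (q - (r + s) / 2) * g q)
        - (c * ((p - r) * (p - s)) / 2 * g' p - c * (p - (r + s) / 2) * g p)
        + c * integral {p..q} g
      \<le> \<Gamma> * (c * (q ^ 3 / 3 - (r + s) * q ^ 2 / 2 + r * s * q) / 2
        - c * (p ^ 3 / 3 - (r + s) * p ^ 2 / 2 + r * s * p) / 2)"
    if "0 \<le> p" "p \<le> q" "q \<le> 1/2" and nonneg: "\<And>t. t \<in> {p..q} \<Longrightarrow> 0 \<le> c * ((t - r) * (t - s))"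
    for c p q r s :: real
  proof -
    have sub: "{p..q} \<subseteq> {0..1/2}"
      using that by auto
    note dg = DERIV_subset[OF g sub] and dg' = DERIV_subset[OF g' sub]
    show ?thesis
      using quadratic_kernel_bounds[OF \<open>p \<le> q\<close>, of g g' g'' c r s \<gamma> \<Gamma>] dg dg' nonneg g'' sub
      by (auto simp: subset_iff)
  qed
  have "continuous_on {0..1/2} g"
    using g by (meson DERIV_continuous continuous_on_eq_continuous_within)
  then have int: "g integrable_on {p..q}" if "0 \<le> p" "q \<le> 1/2" for p q
    using that by (intro integrable_continuous_interval) (auto elim: continuous_on_subset)
  \<comment> \<open>The cuts are the sign changes 7/45 and 1/3 of the kernel and the node 1/4, where
    its formula changes.\<close>
  have split: "integral {0..1/2} g = integral {0..7/45} g + integral {7/45..1/4} g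
      + integral {1/4..1/3} g + integral {1/3..1/2} g"
    using Henstock_Kurzweil_Integration.integral_combine[of 0 "7/45" "1/2" g]
      Henstock_Kurzweil_Integration.integral_combine[of "7/45" "1/4" "1/2" g]
      Henstock_Kurzweil_Integration.integral_combine[of "1/4" "1/3" "1/2" g] int
    by simp
  \<comment> \<open>On each piece \<open>c\<close> is chosen so that the weight is the absolute
    value of the kernel: \<open>c = -1\<close> where the kernel is nonnegative, \<open>c = 1\<close>
    where it is nonpositive.\<close>
  have 1: "0 \<le> -1 * ((t - 0) * (t - 7/45))" if "t \<in> {0..7/45}" for t :: real
    using that mult_nonneg_nonneg[of t "7/45 - t"] by (simp add: algebra_simps)
  have 2: "0 \<le> 1 * ((t - 0) * (t - 7/45))" if "t \<in> {7/45..1/4}" for t :: real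
    using that by simp
  have 3: "0 \<le> 1 * ((t - 1/3) * (t - 8/15))" if "t \<in> {1/4..1/3}" for t :: real
    using that by (simp add: mult_nonpos_nonpos)
  have 4: "0 \<le> -1 * ((t - 1/3) * (t - 8/15))" if "t \<in> {1/3..1/2}" for t :: real
    using that mult_nonneg_nonneg[of "t - 1/3" "8/15 - t"] by (simp add: mult_nonneg_nonpos)
  note pieces = bounds[OF _ _ _ 1, of 0 "7/45"] bounds[OF _ _ _ 2, of "7/45" "1/4"]
    bounds[OF _ _ _ 3, of "1/4" "1/3"] bounds[OF _ _ _ 4, of "1/3" "1/2"]
  show ?thesis
    \<comment> \<open>Adding the pieces with \<open>c = -1\<close> and subtracting those with
      \<open>c = 1\<close> gives the error. The weights of both groups have total integral
      509/546750, so only \<Gamma> - \<gamma> remains. All is linear in \<gamma>, \<Gamma>, the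
      integrals and the values of \<open>g\<close> and \<open>g'\<close>.\<close>
    using pieces[simplified, simplified power2_eq_square power3_eq_cube, simplified] split
    unfolding abs_le_iff by argo
qed

theorem theorem8:
  fixes I :: "real set" and a b \<gamma> \<Gamma> :: real and f f' f'' :: "real \<Rightarrow> real"
  assumes "open I" and "is_interval I"
    and "a \<in> I" and "b \<in> I" and "a < b"
    and "\<And>t. t \<in> I \<Longrightarrow> (f has_real_derivative f' t) (at t)"
    and "\<And>t. t \<in> I \<Longrightarrow> (f' has_real_derivative f'' t) (at t)"
    and "\<And>t. t \<in> {a..b} \<Longrightarrow> \<gamma> \<le> f'' t \<and> f'' t \<le> \<Gamma>"
  shows "\<bar>(b - a) / 90 * (7 * f a + 32 * f ((3 * a + b) / 4) + 12 * f ((a + b) / 2)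
            + 32 * f ((a + 3 * b) / 4) + 7 * f b)
          - integral {a..b} f\<bar>
         \<le> 509 / 273375 * (\<Gamma> - \<gamma>) * (b - a) ^ 3"
proof -
  define L m where "L = b - a" and "m = (a + b) / 2"
  have "L > 0" "a + L / 2 = m" "b - L / 2 = m" "a \<le> m" "m \<le> b"
    using \<open>a < b\<close> by (auto simp: L_def m_def field_simps)
  have sub: "{a..b} \<subseteq> I"
    using assms(2-4) by (meson atLeastAtMost_iff is_interval_1 subsetI)
  have df: "(f has_real_derivative f' t) (at t)" if "t \<in> {a..b}" for t
    using assms(6) sub that by blast
  have df': "(f' has_real_derivative f'' t) (at t)" if "t \<in> {a..b}" for t
    using assms(7) sub that by blast
  have "continuous_on {a..b} f"
    using df by (meson DERIV_isCont continuous_at_imp_continuous_on)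
  then have int: "f integrable_on {p..q}" if "a \<le> p" "q \<le> b" for p q
    using that by (intro integrable_continuous_interval) (auto elim: continuous_on_subset)
  \<comment> \<open>Serves both halves: \<open>x = a\<close>, \<open>d = L\<close> for the left one,
    \<open>x = b\<close>, \<open>d = - L\<close> for the reflected right one. The second derivative
    scales by the square of \<open>d\<close>, so its bounds keep their order, while the
    \<open>f'\<close> term changes sign with \<open>d\<close>.\<close>
  have half: "\<bar>7/90 * f x + 32/90 * f (x + d / 4) + 6/90 * f (x + d / 2)
          + d * f' (x + d / 2) / 360 - integral {0..1/2} (\<lambda>t. f (x + d * t))\<bar>
          \<le> 509/546750 * (d\<^sup>2 * \<Gamma> - d\<^sup>2 * \<gamma>)"
    if x: "\<And>t. t \<in> {0..1/2} \<Longrightarrow> x + d * t \<in> {a..b}" for x d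
  proof -
    have affine: "((\<lambda>t. x + d * t) has_real_derivative d) (at t within {0..1/2})" for t
      by (rule derivative_eq_intros refl | simp)+
    have 1: "((\<lambda>t. f (x + d * t)) has_real_derivative d * f' (x + d * t)) (at t within {0..1/2})"
      if "t \<in> {0..1/2}" for t
      using DERIV_chain2[OF df[OF x[OF that]] affine] by (simp add: mult.commute)
    have 2: "((\<lambda>t. d * f' (x + d * t)) has_real_derivative d\<^sup>2 * f'' (x + d * t))
        (at t within {0..1/2})" if "t \<in> {0..1/2}" for t
      using DERIV_cmult[OF DERIV_chain2[OF df'[OF x[OF that]] affine], of d]
      by (simp add: power2_eq_square ac_simps)
    have 3: "d\<^sup>2 * \<gamma> \<le> d\<^sup>2 * f'' (x + d * t) \<and> d\<^sup>2 * f'' (x + d * t) \<le> d\<^sup>2 * \<Gamma>"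
      if "t \<in> {0..1/2}" for t
      using assms(8)[OF x[OF that]] by (simp add: mult_left_mono)
    show ?thesis
      using boole_half_interval_bound[OF 1 2 3] by simp
  qed
  have left: "integral {0..1/2} (\<lambda>t. f (a + L * t)) = integral {a..m} f / L"
  proof -
    have "(f has_integral integral {a..m} f) (cbox a m)"
      using int \<open>m \<le> b\<close> by (simp add: integrable_integral)
    from has_integral_affinity[OF this, of L a]
    have "((\<lambda>t. f (a + L * t)) has_integral integral {a..m} f / L)
        ((\<lambda>x. (1 / L) * x + - ((1 / L) * a)) ` {a..m})"
      using \<open>L > 0\<close> by (simp add: add.commute)
    also have "(\<lambda>x. (1 / L) * x + - ((1 / L) * a)) ` {a..m} = {0..1/2}"
      unfolding image_affinity_atLeastAtMost
      using \<open>L > 0\<close> \<open>a \<le> m\<close> \<open>a + L / 2 = m\<close>[symmetric] by (simp add: field_simps)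
    finally show ?thesis
      by (rule integral_unique)
  qed
  have right: "integral {0..1/2} (\<lambda>t. f (b + (- L) * t)) = integral {m..b} f / L"
  proof -
    have "(f has_integral integral {m..b} f) (cbox m b)"
      using int \<open>a \<le> m\<close> by (simp add: integrable_integral)
    \<comment> \<open>The scaling factor enters by its absolute value, so the reflection still
      divides the integral by \<open>L\<close>.\<close>
    from has_integral_affinity[OF this, of "- L" b]
    have "((\<lambda>t. f (b + (- L) * t)) has_integral integral {m..b} f / L)
        ((\<lambda>x. (1 / (- L)) * x + - ((1 / (- L)) * b)) ` {m..b})"
      using \<open>L > 0\<close> by (simp add: add.commute)
    also have "(\<lambda>x. (1 / (- L)) * x + - ((1 / (- L)) * b)) ` {m..b} = {0..1/2}"
      unfolding image_affinity_atLeastAtMost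
      using \<open>L > 0\<close> \<open>m \<le> b\<close> \<open>b - L / 2 = m\<close>[symmetric] by (simp add: field_simps)
    finally show ?thesis
      by (rule integral_unique)
  qed
  have rescaled: "a + L * t \<in> {a..b}" "b + (- L) * t \<in> {a..b}" if "t \<in> {0..1/2}" for t
  proof -
    have "0 \<le> L * t" "L * t \<le> L * 1"
      using that \<open>L > 0\<close> by (auto intro!: mult_nonneg_nonneg mult_left_mono simp del: mult_1_right)
    moreover have "b = a + L"
      by (simp add: L_def)
    ultimately show "a + L * t \<in> {a..b}" "b + (- L) * t \<in> {a..b}"
      by simp_all
  qed
  have "\<bar>7/90 * f a + 32/90 * f (a + L / 4) + 6/90 * f m + L * f' m / 360 - integral {a..m} f / L\<bar>
          \<le> 509/546750 * (L\<^sup>2 * \<Gamma> - L\<^sup>2 * \<gamma>)"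
    using half[OF rescaled(1)] left \<open>a + L / 2 = m\<close> by simp
  moreover have "\<bar>7/90 * f b + 32/90 * f (b - L / 4) + 6/90 * f m - L * f' m / 360
          - integral {m..b} f / L\<bar> \<le> 509/546750 * (L\<^sup>2 * \<Gamma> - L\<^sup>2 * \<gamma>)"
    using half[OF rescaled(2)] right \<open>b - L / 2 = m\<close> by simp
  moreover have "integral {a..b} f = integral {a..m} f + integral {m..b} f"
    using Henstock_Kurzweil_Integration.integral_combine[of a m b f] int \<open>a \<le> m\<close> \<open>m \<le> b\<close> by simp
  \<comment> \<open>In the sum of the two estimates the terms \<open>L * f' m / 360\<close> cancel,
    the midpoint weights add up to 12/90, and the constant doubles to 509/273375.\<close>
  ultimately have "\<bar>7/90 * f a + 32/90 * f (a + L / 4) + 12/90 * f m + 32/90 * f (b - L / 4)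
      + 7/90 * f b - integral {a..b} f / L\<bar> \<le> 509/273375 * (L\<^sup>2 * (\<Gamma> - \<gamma>))" (is "\<bar>?e\<bar> \<le> ?B")
    by (simp add: abs_le_iff add_divide_distrib right_diff_distrib)
  \<comment> \<open>Multiplying by \<open>L\<close> undoes the rescaling of the integral and
    supplies the third power of \<open>L\<close>.\<close>
  then have "L * \<bar>?e\<bar> \<le> L * ?B"
    using \<open>L > 0\<close> by (simp add: mult_left_mono)
  then have "\<bar>L * ?e\<bar> \<le> 509/273375 * (\<Gamma> - \<gamma>) * L ^ 3"
    using \<open>L > 0\<close> by (simp add: abs_mult power2_eq_square power3_eq_cube ac_simps)
  also have "L * ?e = L / 90 * (7 * f a + 32 * f (a + L / 4) + 12 * f m + 32 * f (b - L / 4)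
      + 7 * f b) - integral {a..b} f"
    using \<open>L > 0\<close> by (simp add: field_simps)
  also have "a + L / 4 = (3 * a + b) / 4"
    by (simp add: L_def field_simps)
  also have "b - L / 4 = (a + 3 * b) / 4"
    by (simp add: L_def field_simps)
  finally show ?thesis
    unfolding L_def m_def .
qed

end
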